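(* Let $X$ be a topological space. If $\sigma_2=\sigma_7$ as operations on subsets of $X$ (that is, $\sigma_2(A)=\sigma_7(A)$ for every $A\subseteq X$), then $\sigma_0=\sigma_2$ (that is, $A=A^{-}$ for every $A\subseteq X$).
   Context: For a subset $A$ of a topological space $X$, $A^{-}$ denotes the closure of $A$ and $A^{c}=X\setminus A$; superscripts are applied successively from left to right. The operations are $\sigma_0(A)=A$, $\sigma_2(A)=A^{-}$, and $\sigma_7(A)=A^{c-c-}$ (the closure of the interior of $A$). *)

theory Defs
  imports "HOL-Analysis.Analysis"
begin

text \<open>The carrier of the space is \<open>topspace X\<close>, so complements are relative to it;
  the operations are meant to be applied only to subsets of \<open>topspace X\<close>.\<close>

definition compl_in :: "'a topology \<Rightarrow> 'a set \<Rightarrow> 'a set"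
  where "compl_in X A = topspace X - A"

definition sigma0 :: "'a topology \<Rightarrow> 'a set \<Rightarrow> 'a set"
  where "sigma0 X A = A"

definition sigma2 :: "'a topology \<Rightarrow> 'a set \<Rightarrow> 'a set"
  where "sigma2 X A = X closure_of A"

text \<open>Superscripts act from left to right: \<open>A\<close> is first complemented, then closed,
  complemented and closed again.\<close>

definition sigma7 :: "'a topology \<Rightarrow> 'a set \<Rightarrow> 'a set"
  where "sigma7 X A = X closure_of (compl_in X (X closure_of (compl_in X A)))"

end

theory Submission
  imports Defs
begin

text \<open>Applied to a singleton, the hypothesis says that its interior cannot be empty, since the
  closure of the interior contains the point. So every singleton is open and the space is discrete.\<close>

theorem proposition10p2:
  fixes X :: "'a topology"
  assumes "\<forall>A. A \<subseteq> topspace X \<longrightarrow> sigma2 X A = sigma7 X A"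
  shows "\<forall>A. A \<subseteq> topspace X \<longrightarrow> sigma0 X A = sigma2 X A"
proof -
  \<comment> \<open>This says that \<open>x\<close> is interior to \<open>{x}\<close>, written with
    the closure of the complement to match the form of \<open>sigma7\<close>.\<close>
  have singleton: "x \<notin> X closure_of (topspace X - {x})" if x: "x \<in> topspace X" for x
  proof
    assume "x \<in> X closure_of (topspace X - {x})"
    moreover have "topspace X - {x} \<subseteq> X closure_of (topspace X - {x})"
      by (simp add: closure_of_subset)
    \<comment> \<open>The closure contains \<open>x\<close> and every other point, so it is the
      whole space.\<close>
    ultimately have "topspace X - X closure_of (topspace X - {x}) = {}"
      by blast
    then have "sigma7 X {x} = {}"
      by (simp only: sigma7_def compl_in_def closure_of_empty)
    then have "X closure_of {x} = {}"
      using assms x by (simp add: sigma2_def)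
    then show False
      using closure_of_subset[of "{x}" X] x by simp
  qed
  have "X closure_of A \<subseteq> A" if A: "A \<subseteq> topspace X" for A
  proof
    fix x assume x: "x \<in> X closure_of A"
    show "x \<in> A"
    proof (rule ccontr)
      assume "x \<notin> A"
      \<comment> \<open>The complement of \<open>{x}\<close> is the largest set missing
        \<open>x\<close>, and by \<open>singleton\<close> even its closure misses
        \<open>x\<close>.\<close>
      then have "X closure_of A \<subseteq> X closure_of (topspace X - {x})"
        using A by (intro closure_of_mono) blast
      then show False
        using x singleton in_closure_of by fast
    qed
  qed
  then show ?thesis
    by (simp add: sigma0_def sigma2_def closure_of_subset subset_antisym)
qed

end
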